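(* Let $(k,|\cdot|)$ be a complete non-Archimedean field of characteristic $p>0$ with nontrivial value group. The following are equivalent: (i) $T_n(k)$ is Frobenius split for each integer $n>0$; (ii) $T_n(k)$ has a nonzero $p^{-1}$-linear map for each integer $n>0$; (iii) there exists an integer $n>0$ for which $T_n(k)$ has a nonzero $p^{-1}$-linear map; (iv) $T_1(k)$ has a nonzero $p^{-1}$-linear map; (v) $T_1(k)$ is Frobenius split; (vi) there exists a nonzero continuous $k$-linear map $f\colon k^{1/p}\to k$.
   Context: A non-Archimedean field $(k,|\cdot|)$ is a field with a map $|\cdot|\colon k\to\mathbb{R}_{\ge0}$ satisfying $|x|=0$ iff $x=0$, $|x+y|\le\max\{|x|,|y|\}$, $|xy|=|x||y|$, assumed complete and with $|k^\times|\ne\{1\}$. The Tate algebra $T_n(k)$ is the subring of $k[[X_1,\dots,X_n]]$ of series $\sum_\nu a_\nu X^\nu$ with $|a_\nu|\to0$ as $\nu_1+\dots+\nu_n\to\infty$. For a ring $R$ of characteristic $p$, $F_{R*}R$ is $R$ with $R$-module structure $r\cdot x=r^px$; an $R$-linear map $F_{R*}R\to R$ is a $p^{-1}$-linear map; $R$ is Frobenius split if some $p^{-1}$-linear map sends $1\mapsto1$. The field $k^{1/p}$ of $p$-th roots of elements of $k$ (identified with $F_{k*}k$) carries the unique absolute value extending $|\cdot|$, making it a normed $k$-vector space; continuity refers to the metric topologies on $k^{1/p}$ and $k$. *)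

theory Defs
  imports Complex_Main "HOL-Algebra.Ring"
begin

definition nonarch_abs :: "('a::field \<Rightarrow> real) \<Rightarrow> bool" where
  "nonarch_abs v \<longleftrightarrow>
     (\<forall>x. v x \<ge> 0) \<and> (\<forall>x. v x = 0 \<longleftrightarrow> x = 0) \<and>
     (\<forall>x y. v (x + y) \<le> max (v x) (v y)) \<and>
     (\<forall>x y. v (x * y) = v x * v y)"

definition abs_complete :: "('a::field \<Rightarrow> real) \<Rightarrow> bool" where
  "abs_complete v \<longleftrightarrow>
     (\<forall>X :: nat \<Rightarrow> 'a.
        (\<forall>e>0. \<exists>N. \<forall>m\<ge>N. \<forall>n\<ge>N. v (X m - X n) < e) \<longrightarrow>
        (\<exists>L. \<forall>e>0. \<exists>N. \<forall>n\<ge>N. v (X n - L) < e))"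

definition abs_nontrivial :: "('a::field \<Rightarrow> real) \<Rightarrow> bool" where
  "abs_nontrivial v \<longleftrightarrow> (\<exists>x. x \<noteq> 0 \<and> v x \<noteq> 1)"

definition multi_idx :: "nat \<Rightarrow> (nat \<Rightarrow> nat) set" where
  "multi_idx n = {\<nu>. \<forall>i\<ge>n. \<nu> i = 0}"

definition tdeg :: "nat \<Rightarrow> (nat \<Rightarrow> nat) \<Rightarrow> nat" where
  "tdeg n \<nu> = (\<Sum>i<n. \<nu> i)"

definition tate_carrier :: "('a::field \<Rightarrow> real) \<Rightarrow> nat \<Rightarrow> ((nat \<Rightarrow> nat) \<Rightarrow> 'a) set" where
  "tate_carrier v n =
     {a. (\<forall>\<nu>. \<nu> \<notin> multi_idx n \<longrightarrow> a \<nu> = 0) \<and>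
         (\<forall>e>0. \<exists>N. \<forall>\<nu>\<in>multi_idx n. N \<le> tdeg n \<nu> \<longrightarrow> v (a \<nu>) < e)}"

definition tate_ring :: "('a::field \<Rightarrow> real) \<Rightarrow> nat \<Rightarrow> ((nat \<Rightarrow> nat) \<Rightarrow> 'a) ring" where
  "tate_ring v n =
     \<lparr> carrier = tate_carrier v n,
       mult = (\<lambda>a b \<nu>. if \<nu> \<in> multi_idx n
                         then (\<Sum>\<mu>\<in>{\<mu>. \<forall>i. \<mu> i \<le> \<nu> i}. a \<mu> * b (\<lambda>i. \<nu> i - \<mu> i))
                         else 0),
       one = (\<lambda>\<nu>. if \<nu> = (\<lambda>_. 0) then 1 else 0),
       zero = (\<lambda>_. 0),
       add = (\<lambda>a b \<nu>. a \<nu> + b \<nu>) \<rparr>"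

text \<open>An \<open>R\<close>-linear map \<open>F_*R \<rightarrow> R\<close>: additive, and \<open>\<phi>(r^p x) = r \<phi>(x)\<close>.\<close>
definition p_inv_linear :: "('b, 'm) ring_scheme \<Rightarrow> nat \<Rightarrow> ('b \<Rightarrow> 'b) \<Rightarrow> bool" where
  "p_inv_linear R p \<phi> \<longleftrightarrow>
     (\<forall>x\<in>carrier R. \<phi> x \<in> carrier R) \<and>
     (\<forall>x\<in>carrier R. \<forall>y\<in>carrier R. \<phi> (x \<oplus>\<^bsub>R\<^esub> y) = \<phi> x \<oplus>\<^bsub>R\<^esub> \<phi> y) \<and>
     (\<forall>r\<in>carrier R. \<forall>x\<in>carrier R. \<phi> ((r [^]\<^bsub>R\<^esub> p) \<otimes>\<^bsub>R\<^esub> x) = r \<otimes>\<^bsub>R\<^esub> \<phi> x)"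

definition has_nonzero_p_inv_linear :: "('b, 'm) ring_scheme \<Rightarrow> nat \<Rightarrow> bool" where
  "has_nonzero_p_inv_linear R p \<longleftrightarrow>
     (\<exists>\<phi>. p_inv_linear R p \<phi> \<and> (\<exists>x\<in>carrier R. \<phi> x \<noteq> \<zero>\<^bsub>R\<^esub>))"

definition frobenius_split :: "('b, 'm) ring_scheme \<Rightarrow> nat \<Rightarrow> bool" where
  "frobenius_split R p \<longleftrightarrow> (\<exists>\<phi>. p_inv_linear R p \<phi> \<and> \<phi> \<one>\<^bsub>R\<^esub> = \<one>\<^bsub>R\<^esub>)"

text \<open>\<open>k^{1/p}\<close> is identified with \<open>F_{k*}k\<close>: the element \<open>x^{1/p}\<close> is represented by \<open>x\<close>,
  scalar multiplication by \<open>c \<in> k\<close> becomes multiplication by \<open>c^p\<close>, and the extended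
  absolute value is \<open>|x^{1/p}| = |x|^{1/p}\<close>. A map \<open>f : k^{1/p} \<rightarrow> k\<close> is thus a map
  \<open>g : k \<rightarrow> k\<close>, with \<open>g x = f (x^{1/p})\<close>.\<close>
definition cont_lin_root_map :: "('a::field \<Rightarrow> real) \<Rightarrow> nat \<Rightarrow> ('a \<Rightarrow> 'a) \<Rightarrow> bool" where
  "cont_lin_root_map v p g \<longleftrightarrow>
     (\<forall>x y. g (x + y) = g x + g y) \<and>
     (\<forall>c x. g (c ^ p * x) = c * g x) \<and>
     (\<forall>x. \<forall>e>0. \<exists>d>0. \<forall>y. v (y - x) powr (1 / real p) < d \<longrightarrow> v (g y - g x) < e)"

end

theory Submission
  imports Defs "HOL-Computational_Algebra.Primes"
begin

text \<open>
  A continuous functional \<open>g\<close>, normalised by \<open>g 1 = 1\<close>, gives the splitting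
  \<open>\<Sum> a\<^sub>\<nu> X\<^sup>\<nu> \<mapsto> \<Sum> g(a\<^bsub>p\<nu>\<^esub>) X\<^sup>\<nu>\<close> of every \<open>T\<^sub>n\<close>; it is linear because the Frobenius acts
  coefficientwise, \<open>r\<^sup>p = \<Sum> r\<^sub>\<nu>\<^sup>p X\<^bsup>p\<nu>\<^esup>\<close>.

  Conversely, let \<open>\<phi>\<close> be a \<open>p\<^sup>-\<^sup>1\<close>-linear map on \<open>T\<^sub>n\<close> whose value at \<open>a\<close> has a nonzero
  coefficient at \<open>\<mu>\<close>. Then \<open>f c = \<phi>(c a)\<^sub>\<mu>\<close> is a nonzero functional, and it is automatically
  continuous: otherwise \<open>f\<close> is unbounded near 0, and one can choose inductively \<open>c\<^sub>m \<rightarrow> 0\<close> with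
  \<open>f c\<^sub>m\<close> so large that, with \<open>t > \<mu>\<^sub>0\<close>, the series \<open>\<phi>(\<Sum> c\<^sub>m X\<^sub>0\<^bsup>ptm\<^esup> a) = \<Sum> X\<^sub>0\<^bsup>tm\<^esup> \<phi>(c\<^sub>m a)\<close>
  has infinitely many coefficients of absolute value at least 1.
\<close>

section \<open>Multi-indices\<close>

abbreviation below :: "(nat \<Rightarrow> nat) \<Rightarrow> (nat \<Rightarrow> nat) set" where
  "below \<nu> \<equiv> {\<mu>. \<forall>i. \<mu> i \<le> \<nu> i}"

lemma below_multi_idx: "\<nu> \<in> multi_idx n \<Longrightarrow> \<mu> \<in> below \<nu> \<Longrightarrow> \<mu> \<in> multi_idx n"
  by (auto simp: multi_idx_def) (metis le_zero_eq)

text \<open>The members of \<open>below \<nu>\<close> vanish outside the first n variables, and the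
  total degree of \<open>\<nu>\<close> bounds all their entries at once.\<close>

lemma finite_below:
  assumes "\<nu> \<in> multi_idx n"
  shows "finite (below \<nu>)"
proof (rule finite_subset)
  have bound: "\<mu> i \<le> (\<Sum>j<n. \<nu> j)" if "i < n" "\<mu> \<in> below \<nu>" for i \<mu>
    using that member_le_sum[of i "{..<n}" \<nu>] by (auto intro: order_trans)
  show "below \<nu> \<subseteq> {f. \<forall>x. (x \<in> {..<n} \<longrightarrow> f x \<in> {..\<Sum>j<n. \<nu> j}) \<and> (x \<notin> {..<n} \<longrightarrow> f x = 0)}"
    using assms bound below_multi_idx[OF assms] by (auto simp: multi_idx_def)
  show "finite {f. \<forall>x. (x \<in> {..<n} \<longrightarrow> f x \<in> {..\<Sum>j<n. \<nu> j}) \<and> (x \<notin> {..<n} \<longrightarrow> f x = (0::nat))}"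
    by (rule finite_set_of_finite_funs) auto
qed

lemma minus_multi_idx: "\<nu> \<in> multi_idx n \<Longrightarrow> (\<lambda>i. \<nu> i - \<mu> i) \<in> multi_idx n"
  by (auto simp: multi_idx_def)

lemma zero_multi_idx: "(\<lambda>_. 0) \<in> multi_idx n"
  by (simp add: multi_idx_def)

lemma tdeg_split: "\<mu> \<in> below \<nu> \<Longrightarrow> tdeg n \<mu> + tdeg n (\<lambda>i. \<nu> i - \<mu> i) = tdeg n \<nu>"
  unfolding tdeg_def by (simp flip: sum.distrib)

text \<open>Each entry is at most the degree, so everything lies in a box of side N. This is why the
  decay condition leaves only finitely many coefficients uncontrolled.\<close>

lemma finite_tdeg_less: "finite {\<nu> \<in> multi_idx n. tdeg n \<nu> < N}"
proof (rule finite_subset)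
  let ?b = "\<lambda>i. if i < n then N else 0"
  have "\<nu> i \<le> tdeg n \<nu>" if "i < n" for i \<nu>
    unfolding tdeg_def using that by (intro member_le_sum) auto
  then show "{\<nu> \<in> multi_idx n. tdeg n \<nu> < N} \<subseteq> below ?b"
    by (auto simp: multi_idx_def) (meson le_trans less_imp_le_nat)
  show "finite (below ?b)"
    by (rule finite_below[of _ n]) (simp add: multi_idx_def)
qed

text \<open>Both sides sum \<open>a \<kappa> * b \<lambda> * c \<rho>\<close> over the triples with
  \<open>\<kappa> + \<lambda> + \<rho> = \<nu>\<close>; passing from
  \<open>(\<mu>, \<kappa>)\<close> to \<open>(\<kappa>, \<mu> - \<kappa>)\<close> changes one
  parametrisation into the other. This yields associativity of the product.\<close>

lemma sum_below_assoc:
  fixes a b c :: "(nat \<Rightarrow> nat) \<Rightarrow> 'a::comm_semiring_0"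
  assumes "\<nu> \<in> multi_idx n"
  shows "(\<Sum>\<mu>\<in>below \<nu>. (\<Sum>\<kappa>\<in>below \<mu>. a \<kappa> * b (\<lambda>i. \<mu> i - \<kappa> i)) * c (\<lambda>i. \<nu> i - \<mu> i)) =
         (\<Sum>\<kappa>\<in>below \<nu>. a \<kappa> * (\<Sum>\<mu>\<in>below (\<lambda>i. \<nu> i - \<kappa> i). b \<mu> * c (\<lambda>i. \<nu> i - \<kappa> i - \<mu> i)))"
proof -
  have fin: "finite (below \<nu>)" "\<And>\<mu>. \<mu> \<in> below \<nu> \<Longrightarrow> finite (below \<mu>)"
       "\<And>\<kappa>. finite (below (\<lambda>i. \<nu> i - \<kappa> i))"
    using assms finite_below below_multi_idx minus_multi_idx by blast+
  have "(\<Sum>\<mu>\<in>below \<nu>. (\<Sum>\<kappa>\<in>below \<mu>. a \<kappa> * b (\<lambda>i. \<mu> i - \<kappa> i)) * c (\<lambda>i. \<nu> i - \<mu> i)) =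
      (\<Sum>(\<mu>,\<kappa>)\<in>Sigma (below \<nu>) below. a \<kappa> * b (\<lambda>i. \<mu> i - \<kappa> i) * c (\<lambda>i. \<nu> i - \<mu> i))"
    using fin by (subst sum.Sigma[symmetric]) (auto simp: sum_distrib_right)
  also have "\<dots> = (\<Sum>(\<kappa>,\<mu>)\<in>Sigma (below \<nu>) (\<lambda>\<kappa>. below (\<lambda>i. \<nu> i - \<kappa> i)).
      a \<kappa> * (b \<mu> * c (\<lambda>i. \<nu> i - \<kappa> i - \<mu> i)))"
  proof (rule sum.reindex_bij_witness[where
        i = "\<lambda>(\<kappa>,\<mu>). (\<lambda>i. \<kappa> i + \<mu> i, \<kappa>)" and j = "\<lambda>(\<mu>,\<kappa>). (\<kappa>, \<lambda>i. \<mu> i - \<kappa> i)"], goal_cases)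
    case (1 x) then show ?case by (auto simp: fun_eq_iff)
  next
    case (2 x) then show ?case by (auto intro: order_trans diff_le_mono)
  next
    case (3 x) then show ?case by (auto simp: fun_eq_iff)
  next
    case (4 x)
    then obtain \<kappa> \<mu> where x: "x = (\<kappa>, \<mu>)" "\<And>i. \<kappa> i \<le> \<nu> i" "\<And>i. \<mu> i \<le> \<nu> i - \<kappa> i"
      by (cases x) auto
    have "\<kappa> i + \<mu> i \<le> \<nu> i" for i
      using x(2)[of i] x(3)[of i] by linarith
    then show ?case by (simp add: x(1))
  next
    case (5 x) then show ?case by (auto simp: mult.assoc)
  qed
  also have "\<dots> = (\<Sum>\<kappa>\<in>below \<nu>. a \<kappa> * (\<Sum>\<mu>\<in>below (\<lambda>i. \<nu> i - \<kappa> i). b \<mu> * c (\<lambda>i. \<nu> i - \<kappa> i - \<mu> i)))"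
    using fin by (subst sum.Sigma[symmetric]) (auto simp: sum_distrib_left)
  finally show ?thesis .
qed

text \<open>The reflection \<open>\<mu> \<mapsto> \<nu> - \<mu>\<close> is an involution of
  \<open>below \<nu>\<close> that exchanges the two factors.\<close>

lemma sum_below_commute:
  fixes a b :: "(nat \<Rightarrow> nat) \<Rightarrow> 'a::comm_semiring_0"
  shows "(\<Sum>\<mu>\<in>below \<nu>. a \<mu> * b (\<lambda>i. \<nu> i - \<mu> i)) = (\<Sum>\<mu>\<in>below \<nu>. b \<mu> * a (\<lambda>i. \<nu> i - \<mu> i))"
  by (rule sum.reindex_bij_witness[where i = "\<lambda>\<mu> i. \<nu> i - \<mu> i" and j = "\<lambda>\<mu> i. \<nu> i - \<mu> i"])
     (auto simp: mult.commute)

text \<open>The monomial \<open>c X^\<alpha>\<close>. At exponent 0 it embeds the field in the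
  algebra, which is how scalars act later.\<close>

definition mterm :: "'a \<Rightarrow> (nat \<Rightarrow> nat) \<Rightarrow> (nat \<Rightarrow> nat) \<Rightarrow> 'a::zero" where
  "mterm c \<alpha> = (\<lambda>\<nu>. if \<nu> = \<alpha> then c else 0)"

lemma sum_mterm_below:
  fixes c :: "'a::comm_semiring_0"
  assumes "\<nu> \<in> multi_idx n"
  shows "(\<Sum>\<mu>\<in>below \<nu>. mterm c \<alpha> \<mu> * b (\<lambda>i. \<nu> i - \<mu> i)) =
         (if \<alpha> \<in> below \<nu> then c * b (\<lambda>i. \<nu> i - \<alpha> i) else 0)"
proof -
  have "(\<Sum>\<mu>\<in>below \<nu>. mterm c \<alpha> \<mu> * b (\<lambda>i. \<nu> i - \<mu> i)) =
        (\<Sum>\<mu>\<in>below \<nu>. if \<mu> = \<alpha> then c * b (\<lambda>i. \<nu> i - \<alpha> i) else 0)"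
    by (rule sum.cong) (auto simp: mterm_def)
  then show ?thesis
    using finite_below[OF assms] by (simp add: sum.delta)
qed

section \<open>The Tate algebra as a commutative ring\<close>

lemma tate_ring_simps:
  "carrier (tate_ring v n) = tate_carrier v n"
  "x \<oplus>\<^bsub>tate_ring v n\<^esub> y = (\<lambda>\<nu>. x \<nu> + y \<nu>)"
  "\<zero>\<^bsub>tate_ring v n\<^esub> = (\<lambda>_. 0)"
  "\<one>\<^bsub>tate_ring v n\<^esub> = mterm 1 (\<lambda>_. 0)"
  by (auto simp: tate_ring_def mterm_def)

lemma tate_mult:
  "(x \<otimes>\<^bsub>tate_ring v n\<^esub> y) \<nu> =
     (if \<nu> \<in> multi_idx n then \<Sum>\<mu>\<in>below \<nu>. x \<mu> * y (\<lambda>i. \<nu> i - \<mu> i) else 0)"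
  by (simp add: tate_ring_def)

lemma tate_mult_mterm:
  assumes "\<nu> \<in> multi_idx n"
  shows "(mterm c \<alpha> \<otimes>\<^bsub>tate_ring v n\<^esub> b) \<nu> = (if \<alpha> \<in> below \<nu> then c * b (\<lambda>i. \<nu> i - \<alpha> i) else 0)"
  using assms by (simp add: tate_mult sum_mterm_below)

lemma tate_carrier_outside: "a \<in> tate_carrier v n \<Longrightarrow> \<nu> \<notin> multi_idx n \<Longrightarrow> a \<nu> = 0"
  by (auto simp: tate_carrier_def)

lemma tate_carrier_small:
  assumes "a \<in> tate_carrier v n" "e > 0"
  obtains N where "\<And>\<nu>. \<nu> \<in> multi_idx n \<Longrightarrow> N \<le> tdeg n \<nu> \<Longrightarrow> v (a \<nu>) < e"
  using assms by (force simp: tate_carrier_def)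

section \<open>The absolute value of the coefficient field\<close>

locale nonarch_field =
  fixes v :: "'a::field \<Rightarrow> real"
  assumes nonarch_abs: "nonarch_abs v"
begin

lemma v_nonneg: "v x \<ge> 0"
  and v_eq_0_iff: "v x = 0 \<longleftrightarrow> x = 0"
  and v_add: "v (x + y) \<le> max (v x) (v y)"
  and v_mult: "v (x * y) = v x * v y"
  using nonarch_abs by (auto simp: nonarch_abs_def)

lemma v_0: "v 0 = 0"
  by (simp add: v_eq_0_iff)

lemma v_1: "v 1 = 1"
  using v_mult[of 1 1] v_eq_0_iff[of 1] by simp

lemma v_minus_1: "v (- 1) = 1"
  using v_mult[of "-1" "-1"] v_nonneg[of "-1"] v_1 by (simp add: power2_eq_1_iff flip: power2_eq_square)

lemma v_uminus: "v (- x) = v x"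
  using v_mult[of "-1" x] v_minus_1 by simp

lemma v_power: "v (x ^ m) = v x ^ m"
  by (induction m) (auto simp: v_1 v_mult)

lemma v_inverse: "v (inverse x) = inverse (v x)"
proof (cases "x = 0")
  case False
  then have "v x * v (inverse x) = 1"
    by (simp add: v_1 flip: v_mult)
  then show ?thesis by (rule inverse_unique[symmetric])
qed (simp add: v_0)

text \<open>The ultrametric inequality makes the bound independent of the number of summands;
  positivity of \<open>e\<close> covers the empty sum.\<close>

lemma v_sum_less: "e > 0 \<Longrightarrow> (\<And>i. i \<in> A \<Longrightarrow> v (h i) < e) \<Longrightarrow> v (\<Sum>i\<in>A. h i) < e"
  by (induction A rule: infinite_finite_induct)
     (auto simp: v_0 intro: le_less_trans[OF v_add])

text \<open>A cruder bound than the maximum, but an explicit real number that also makes sense for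
  an empty sum.\<close>

lemma v_sum_le: "v (\<Sum>i\<in>A. h i) \<le> (\<Sum>i\<in>A. v (h i))"
proof (induction A rule: infinite_finite_induct)
  case (insert x F)
  have "v (h x + sum h F) \<le> v (h x) + v (sum h F)"
    using v_add[of "h x" "sum h F"] v_nonneg[of "h x"] v_nonneg[of "sum h F"] by linarith
  with insert show ?case by simp
qed (auto simp: v_0)

text \<open>Beyond some degree all coefficients are smaller than 1, and the finitely many remaining
  ones are bounded by the sum of their absolute values.\<close>

lemma tate_carrier_bounded:
  assumes "a \<in> tate_carrier v n"
  obtains B where "B > 0" "\<And>\<nu>. v (a \<nu>) < B"
proof -
  obtain N where N: "\<And>\<nu>. \<nu> \<in> multi_idx n \<Longrightarrow> N \<le> tdeg n \<nu> \<Longrightarrow> v (a \<nu>) < 1"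
    using tate_carrier_small[OF assms zero_less_one] by blast
  let ?F = "{\<nu> \<in> multi_idx n. tdeg n \<nu> < N}"
  let ?B = "1 + (\<Sum>\<nu>\<in>?F. v (a \<nu>))"
  have pos: "(\<Sum>\<nu>\<in>?F. v (a \<nu>)) \<ge> 0"
    by (intro sum_nonneg v_nonneg)
  have "v (a \<nu>) < ?B" for \<nu>
  proof (cases "\<nu> \<in> multi_idx n")
    case True
    show ?thesis
    proof (cases "tdeg n \<nu> < N")
      case True
      with \<open>\<nu> \<in> multi_idx n\<close> have "v (a \<nu>) \<le> (\<Sum>\<nu>\<in>?F. v (a \<nu>))"
        using finite_tdeg_less v_nonneg by (intro member_le_sum) auto
      then show ?thesis by simp
    next
      case False
      with N[OF True] pos show ?thesis by simp
    qed
  next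
    case False
    with assms pos show ?thesis by (simp add: tate_carrier_outside v_0)
  qed
  with pos show ?thesis by (intro that[of ?B]) auto
qed

section \<open>Ring structure on the convergent power series\<close>

lemma mterm_carrier:
  assumes "\<alpha> \<in> multi_idx n"
  shows "mterm c \<alpha> \<in> tate_carrier v n"
  unfolding tate_carrier_def
proof (safe, goal_cases)
  case (1 \<nu>)
  with assms show ?case by (auto simp: mterm_def)
next
  case (2 e)
  have "v (mterm c \<alpha> \<nu>) < e" if "tdeg n \<nu> \<ge> Suc (tdeg n \<alpha>)" for \<nu>
    using that 2 by (auto simp: mterm_def v_0)
  then show ?case by blast
qed

lemma tate_add_closed:
  assumes "a \<in> tate_carrier v n" "b \<in> tate_carrier v n"
  shows "(\<lambda>\<nu>. a \<nu> + b \<nu>) \<in> tate_carrier v n"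
  unfolding tate_carrier_def
proof (safe, goal_cases)
  case (1 \<nu>)
  with assms show ?case by (simp add: tate_carrier_outside)
next
  case (2 e)
  from 2 obtain N where N: "\<And>\<nu>. \<nu> \<in> multi_idx n \<Longrightarrow> N \<le> tdeg n \<nu> \<Longrightarrow> v (a \<nu>) < e"
    using tate_carrier_small assms(1) by blast
  from 2 obtain M where M: "\<And>\<nu>. \<nu> \<in> multi_idx n \<Longrightarrow> M \<le> tdeg n \<nu> \<Longrightarrow> v (b \<nu>) < e"
    using tate_carrier_small assms(2) by blast
  have "v (a \<nu> + b \<nu>) < e" if "\<nu> \<in> multi_idx n" "max N M \<le> tdeg n \<nu>" for \<nu>
    using N[of \<nu>] M[of \<nu>] that v_add[of "a \<nu>" "b \<nu>"] by auto
  then show ?case by blast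
qed

lemma tate_uminus_closed: "a \<in> tate_carrier v n \<Longrightarrow> (\<lambda>\<nu>. - a \<nu>) \<in> tate_carrier v n"
  by (simp add: tate_carrier_def v_uminus)

text \<open>If \<open>\<nu>\<close> has degree at least N + M, then in each product either
  \<open>\<mu>\<close> has degree at least N or \<open>\<nu> - \<mu>\<close> has degree at least M.
  One factor is then small while the other is bounded, and the ultrametric inequality carries the
  bound over to the sum.\<close>

lemma tate_mult_closed:
  assumes "a \<in> tate_carrier v n" "b \<in> tate_carrier v n"
  shows "a \<otimes>\<^bsub>tate_ring v n\<^esub> b \<in> tate_carrier v n"
  unfolding tate_carrier_def
proof (safe, goal_cases)
  case (1 \<nu>)
  then show ?case by (simp add: tate_mult)
next
  case (2 e)
  obtain A where A: "A > 0" "\<And>\<nu>. v (a \<nu>) < A"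
    using tate_carrier_bounded assms(1) by blast
  obtain B where B: "B > 0" "\<And>\<nu>. v (b \<nu>) < B"
    using tate_carrier_bounded assms(2) by blast
  obtain N where N: "\<And>\<nu>. \<nu> \<in> multi_idx n \<Longrightarrow> N \<le> tdeg n \<nu> \<Longrightarrow> v (a \<nu>) < e / B"
    using tate_carrier_small[OF assms(1), of "e / B"] 2 B by auto
  obtain M where M: "\<And>\<nu>. \<nu> \<in> multi_idx n \<Longrightarrow> M \<le> tdeg n \<nu> \<Longrightarrow> v (b \<nu>) < e / A"
    using tate_carrier_small[OF assms(2), of "e / A"] 2 A by auto
  have "v ((a \<otimes>\<^bsub>tate_ring v n\<^esub> b) \<nu>) < e" if \<nu>: "\<nu> \<in> multi_idx n" "N + M \<le> tdeg n \<nu>" for \<nu>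
  proof -
    have "v (a \<mu> * b (\<lambda>i. \<nu> i - \<mu> i)) < e" if \<mu>: "\<mu> \<in> below \<nu>" for \<mu>
    proof (cases "N \<le> tdeg n \<mu>")
      case True
      then have "v (a \<mu>) * v (b (\<lambda>i. \<nu> i - \<mu> i)) < e / B * B"
        using N[OF below_multi_idx[OF \<nu>(1) \<mu>]] B by (intro mult_strict_mono) (auto simp: v_nonneg 2)
      with B show ?thesis by (simp add: v_mult)
    next
      case False
      with tdeg_split[OF \<mu>, of n] \<nu>(2) have "M \<le> tdeg n (\<lambda>i. \<nu> i - \<mu> i)"
        by linarith
      then have "v (a \<mu>) * v (b (\<lambda>i. \<nu> i - \<mu> i)) < A * (e / A)"
        using M[OF minus_multi_idx[OF \<nu>(1)]] A by (intro mult_strict_mono) (auto simp: v_nonneg 2)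
      with A show ?thesis by (simp add: v_mult)
    qed
    then have "v (\<Sum>\<mu>\<in>below \<nu>. a \<mu> * b (\<lambda>i. \<nu> i - \<mu> i)) < e"
      by (rule v_sum_less[OF 2])
    with \<nu> show ?thesis
      by (simp add: tate_mult)
  qed
  then show ?case by blast
qed

lemma cring_tate_ring: "cring (tate_ring v n)"
proof (rule cringI)
  show "abelian_group (tate_ring v n)"
  proof (rule abelian_groupI, goal_cases)
    case (1 x y)
    then show ?case by (simp add: tate_ring_simps tate_add_closed)
  next
    case (6 x)
    then show ?case
      by (intro bexI[of _ "\<lambda>\<nu>. - x \<nu>"]) (auto simp: tate_ring_simps tate_uminus_closed)
  qed (auto simp: tate_ring_simps add_ac tate_carrier_def v_0)
  have comm: "x \<otimes>\<^bsub>tate_ring v n\<^esub> y = y \<otimes>\<^bsub>tate_ring v n\<^esub> x" for x y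
    by (rule ext) (simp add: tate_mult sum_below_commute[of x])
  show "comm_monoid (tate_ring v n)"
  proof (rule comm_monoidI, goal_cases)
    case (1 x y)
    then show ?case by (simp add: tate_ring_simps tate_mult_closed)
  next
    case 2
    show ?case by (simp add: tate_ring_simps mterm_carrier zero_multi_idx)
  next
    case (3 x y z)
    show ?case
    proof
      fix \<nu>
      show "(x \<otimes>\<^bsub>tate_ring v n\<^esub> y \<otimes>\<^bsub>tate_ring v n\<^esub> z) \<nu> = (x \<otimes>\<^bsub>tate_ring v n\<^esub> (y \<otimes>\<^bsub>tate_ring v n\<^esub> z)) \<nu>"
        using sum_below_assoc[of \<nu> n x y z]
        by (auto simp: tate_mult below_multi_idx minus_multi_idx)
    qed
  next
    case (4 x)
    then show ?case
      by (intro ext) (auto simp: tate_ring_simps tate_mult tate_carrier_outside sum_mterm_below)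
  next
    case (5 x y)
    show ?case by (rule comm)
  qed
  fix x y z
  show "(x \<oplus>\<^bsub>tate_ring v n\<^esub> y) \<otimes>\<^bsub>tate_ring v n\<^esub> z =
      x \<otimes>\<^bsub>tate_ring v n\<^esub> z \<oplus>\<^bsub>tate_ring v n\<^esub> y \<otimes>\<^bsub>tate_ring v n\<^esub> z"
    by (rule ext) (simp add: tate_mult tate_ring_simps sum.distrib distrib_right)
qed

lemma mterm_mult:
  assumes "\<alpha> \<in> multi_idx n" "\<beta> \<in> multi_idx n"
  shows "mterm c \<alpha> \<otimes>\<^bsub>tate_ring v n\<^esub> mterm d \<beta> = mterm (c * d) (\<lambda>i. \<alpha> i + \<beta> i)"
proof
  fix \<nu>
  have sum_idx: "(\<lambda>i. \<alpha> i + \<beta> i) \<in> multi_idx n"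
    using assms by (simp add: multi_idx_def)
  \<comment> \<open>Subtraction is truncated, so \<open>\<nu> - \<alpha> = \<beta>\<close>
    determines \<open>\<nu>\<close> only together with
    \<open>\<alpha> \<in> below \<nu>\<close>.\<close>
  have iff: "\<alpha> \<in> below \<nu> \<and> (\<lambda>i. \<nu> i - \<alpha> i) = \<beta> \<longleftrightarrow> \<nu> = (\<lambda>i. \<alpha> i + \<beta> i)"
    by (auto simp: fun_eq_iff) (metis le_add_diff_inverse)
  show "(mterm c \<alpha> \<otimes>\<^bsub>tate_ring v n\<^esub> mterm d \<beta>) \<nu> = mterm (c * d) (\<lambda>i. \<alpha> i + \<beta> i) \<nu>"
  proof (cases "\<nu> \<in> multi_idx n")
    case True
    show ?thesis
      unfolding tate_mult_mterm[OF True] using iff by (auto simp: mterm_def)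
  next
    case False
    with sum_idx show ?thesis by (auto simp: tate_mult mterm_def)
  qed
qed

lemma mterm_pow:
  assumes "\<alpha> \<in> multi_idx n"
  shows "mterm c \<alpha> [^]\<^bsub>tate_ring v n\<^esub> (m::nat) = mterm (c ^ m) (\<lambda>i. m * \<alpha> i)"
proof -
  interpret cring "tate_ring v n" by (rule cring_tate_ring)
  show ?thesis
  proof (induction m)
    case 0
    show ?case by (simp add: tate_ring_simps)
  next
    case (Suc m)
    have "(\<lambda>i. m * \<alpha> i) \<in> multi_idx n"
      using assms by (simp add: multi_idx_def)
    with Suc assms show ?case
      by (simp add: mterm_mult mult.commute add.commute)
  qed
qed

section \<open>The Frobenius on coefficients\<close>

lemma tate_mult_sum_left:
  "((\<lambda>\<nu>. \<Sum>i\<in>I. k i * x i \<nu>) \<otimes>\<^bsub>tate_ring v n\<^esub> y) \<nu> =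
   (\<Sum>i\<in>I. k i * (x i \<otimes>\<^bsub>tate_ring v n\<^esub> y) \<nu>)"
proof (cases "\<nu> \<in> multi_idx n")
  case True
  have "(\<Sum>\<mu>\<in>below \<nu>. (\<Sum>i\<in>I. k i * x i \<mu>) * y (\<lambda>i. \<nu> i - \<mu> i)) =
        (\<Sum>\<mu>\<in>below \<nu>. \<Sum>i\<in>I. k i * (x i \<mu> * y (\<lambda>i. \<nu> i - \<mu> i)))"
    by (simp add: sum_distrib_right mult.assoc)
  also have "\<dots> = (\<Sum>i\<in>I. \<Sum>\<mu>\<in>below \<nu>. k i * (x i \<mu> * y (\<lambda>i. \<nu> i - \<mu> i)))"
    by (rule sum.swap)
  finally show ?thesis
    using True by (simp add: tate_mult sum_distrib_left)
qed (simp add: tate_mult)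

text \<open>The binomial numbers are read in the field and the expansion is taken coefficientwise,
  so that \<open>CHAR('a)\<close> applies to them directly.\<close>

lemma tate_binomial:
  assumes "x \<in> tate_carrier v n" "y \<in> tate_carrier v n"
  shows "(x \<oplus>\<^bsub>tate_ring v n\<^esub> y) [^]\<^bsub>tate_ring v n\<^esub> m =
    (\<lambda>\<nu>. \<Sum>i\<le>m. of_nat (m choose i) *
           (x [^]\<^bsub>tate_ring v n\<^esub> i \<otimes>\<^bsub>tate_ring v n\<^esub> y [^]\<^bsub>tate_ring v n\<^esub> (m - i)) \<nu>)"
proof (induction m)
  interpret cring "tate_ring v n" by (rule cring_tate_ring)
  case 0
  show ?case by simp
next
  interpret cring "tate_ring v n" by (rule cring_tate_ring)
  let ?R = "tate_ring v n"
  define t where "t i j = x [^]\<^bsub>?R\<^esub> i \<otimes>\<^bsub>?R\<^esub> y [^]\<^bsub>?R\<^esub> j" for i j :: nat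
  case (Suc m)
  have xy: "x \<in> carrier ?R" "y \<in> carrier ?R"
    using assms by (auto simp: tate_ring_simps)
  have t: "t i j \<otimes>\<^bsub>?R\<^esub> (x \<oplus>\<^bsub>?R\<^esub> y) = (\<lambda>\<nu>. t (Suc i) j \<nu> + t i (Suc j) \<nu>)" for i j
  proof -
    have "t i j \<otimes>\<^bsub>?R\<^esub> (x \<oplus>\<^bsub>?R\<^esub> y) = t (Suc i) j \<oplus>\<^bsub>?R\<^esub> t i (Suc j)"
      using xy by (simp add: t_def r_distr m_ac)
    then show ?thesis by (simp add: tate_ring_simps)
  qed
  show ?case
  proof
    fix \<nu>
    have "((x \<oplus>\<^bsub>?R\<^esub> y) [^]\<^bsub>?R\<^esub> Suc m) \<nu> =
        ((\<lambda>\<nu>. \<Sum>i\<le>m. of_nat (m choose i) * t i (m - i) \<nu>) \<otimes>\<^bsub>?R\<^esub> (x \<oplus>\<^bsub>?R\<^esub> y)) \<nu>"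
      by (simp add: Suc t_def)
    also have "\<dots> = (\<Sum>i\<le>m. of_nat (m choose i) * (t (Suc i) (m - i) \<nu> + t i (Suc (m - i)) \<nu>))"
      by (simp only: tate_mult_sum_left t)
    also have "\<dots> = (\<Sum>i\<le>m. of_nat (m choose i) * t (Suc i) (m - i) \<nu>) +
                    (\<Sum>i\<le>m. of_nat (m choose i) * t i (Suc m - i) \<nu>)"
      by (simp add: distrib_left sum.distrib Suc_diff_le)
    \<comment> \<open>The added term at \<open>Suc m\<close> has binomial coefficient 0; it gives
      the sum the right length for the index shift that prepares Pascal's rule.\<close>
    also have "(\<Sum>i\<le>m. of_nat (m choose i) * t i (Suc m - i) \<nu>) =
               (\<Sum>i\<le>Suc m. of_nat (m choose i) * t i (Suc m - i) \<nu>)"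
      by (simp add: binomial_eq_0)
    also have "\<dots> = t 0 (Suc m) \<nu> + (\<Sum>i\<le>m. of_nat (m choose Suc i) * t (Suc i) (m - i) \<nu>)"
      by (subst sum.atMost_Suc_shift) simp
    also have "(\<Sum>i\<le>m. of_nat (m choose i) * t (Suc i) (m - i) \<nu>) + \<dots> =
               (\<Sum>i\<le>Suc m. of_nat (Suc m choose i) * t i (Suc m - i) \<nu>)"
      unfolding sum.atMost_Suc_shift[of "\<lambda>i. of_nat (Suc m choose i) * t i (Suc m - i) \<nu>"]
      by (simp add: sum.distrib distrib_right add_ac)
    finally show "((x \<oplus>\<^bsub>?R\<^esub> y) [^]\<^bsub>?R\<^esub> Suc m) \<nu> =
      (\<Sum>i\<le>Suc m. of_nat (Suc m choose i) * (x [^]\<^bsub>?R\<^esub> i \<otimes>\<^bsub>?R\<^esub> y [^]\<^bsub>?R\<^esub> (Suc m - i)) \<nu>)"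
      by (simp only: t_def)
  qed
qed

text \<open>A positive characteristic of a field is prime, hence p divides every binomial
  coefficient strictly between the two ends.\<close>

lemma tate_freshmans_dream:
  assumes "x \<in> tate_carrier v n" "y \<in> tate_carrier v n" and p: "CHAR('a) = p" "p > 0"
  shows "(x \<oplus>\<^bsub>tate_ring v n\<^esub> y) [^]\<^bsub>tate_ring v n\<^esub> p =
         (\<lambda>\<nu>. (x [^]\<^bsub>tate_ring v n\<^esub> p) \<nu> + (y [^]\<^bsub>tate_ring v n\<^esub> p) \<nu>)"
proof
  fix \<nu>
  interpret cring "tate_ring v n" by (rule cring_tate_ring)
  let ?R = "tate_ring v n"
  have "prime p"
    using prime_CHAR_semidom[where ?'a = 'a] p by simp
  let ?t = "\<lambda>i. of_nat (p choose i) * (x [^]\<^bsub>?R\<^esub> i \<otimes>\<^bsub>?R\<^esub> y [^]\<^bsub>?R\<^esub> (p - i)) \<nu>"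
  have "((x \<oplus>\<^bsub>?R\<^esub> y) [^]\<^bsub>?R\<^esub> p) \<nu> = (\<Sum>i\<le>p. ?t i)"
    by (simp add: tate_binomial assms)
  also have "\<dots> = (\<Sum>i\<in>{0,p}. ?t i)"
  proof (intro sum.mono_neutral_right ballI)
    fix i assume "i \<in> {..p} - {0, p}"
    then have "p dvd (p choose i)"
      using \<open>prime p\<close> by (intro dvd_choose_prime) auto
    then have "of_nat (p choose i) = (0 :: 'a)"
      using p by (simp add: of_nat_eq_0_iff_char_dvd)
    then show "?t i = 0" by simp
  qed auto
  also have "\<dots> = (x [^]\<^bsub>?R\<^esub> p) \<nu> + (y [^]\<^bsub>?R\<^esub> p) \<nu>"
    using assms by (simp add: add.commute flip: tate_ring_simps(1)[of v n])
  finally show "((x \<oplus>\<^bsub>?R\<^esub> y) [^]\<^bsub>?R\<^esub> p) \<nu> = (x [^]\<^bsub>?R\<^esub> p) \<nu> + (y [^]\<^bsub>?R\<^esub> p) \<nu>" .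
qed

lemma tate_carrier_restrict:
  "r \<in> tate_carrier v n \<Longrightarrow> (\<lambda>\<mu>. if \<mu> \<in> A then 0 else r \<mu>) \<in> tate_carrier v n"
  unfolding tate_carrier_def by (auto simp: v_0) blast

text \<open>The freshman's dream handles finite sums only, so a series is treated as finitely many
  monomials plus a remainder; each induction step peels one more monomial off the remainder.\<close>

lemma tate_frobenius_split_off:
  assumes "finite A" "A \<subseteq> multi_idx n" "r \<in> tate_carrier v n" "CHAR('a) = p" "p > 0"
  shows "(r [^]\<^bsub>tate_ring v n\<^esub> p) \<nu> =
    (\<Sum>\<mu>\<in>A. mterm (r \<mu> ^ p) (\<lambda>i. p * \<mu> i) \<nu>) +
    ((\<lambda>\<mu>. if \<mu> \<in> A then 0 else r \<mu>) [^]\<^bsub>tate_ring v n\<^esub> p) \<nu>"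
  using assms(1,2)
proof (induction A rule: finite_induct)
  case empty
  then show ?case by simp
next
  case (insert \<alpha> A)
  let ?R = "tate_ring v n"
  let ?s = "\<lambda>A \<mu>. if \<mu> \<in> A then 0 else r \<mu>"
  have "?s A = mterm (r \<alpha>) \<alpha> \<oplus>\<^bsub>?R\<^esub> ?s (insert \<alpha> A)"
    using insert.hyps by (auto simp: tate_ring_simps mterm_def)
  moreover have "\<alpha> \<in> multi_idx n"
    using insert.prems by simp
  ultimately have "(?s A [^]\<^bsub>?R\<^esub> p) \<nu> =
      mterm (r \<alpha> ^ p) (\<lambda>i. p * \<alpha> i) \<nu> + (?s (insert \<alpha> A) [^]\<^bsub>?R\<^esub> p) \<nu>"
    using assms(3-5) by (simp only: tate_freshmans_dream mterm_carrier tate_carrier_restrict mterm_pow)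
  with insert show ?case by (simp add: add_ac)
qed

text \<open>Split off the monomials of \<open>r\<close> with exponent in \<open>below \<nu>\<close>.
  The remainder cannot affect the coefficient at \<open>\<nu>\<close>, and among the p-th powers of
  the monomials only the one with exponent \<open>\<nu> / p\<close> can.\<close>

lemma tate_frobenius_coeff:
  assumes "r \<in> tate_carrier v n" "\<nu> \<in> multi_idx n" "CHAR('a) = p" "p > 0"
  shows "(r [^]\<^bsub>tate_ring v n\<^esub> p) \<nu> = (if \<forall>i. p dvd \<nu> i then r (\<lambda>i. \<nu> i div p) ^ p else 0)"
proof -
  interpret cring "tate_ring v n" by (rule cring_tate_ring)
  let ?R = "tate_ring v n"
  let ?s = "\<lambda>\<mu>. if \<mu> \<in> below \<nu> then 0 else r \<mu>"
  have fin: "finite (below \<nu>)" "below \<nu> \<subseteq> multi_idx n"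
    using assms(2) finite_below below_multi_idx by blast+
  obtain q where q: "p = Suc q"
    using \<open>p > 0\<close> gr0_implies_Suc by blast
  \<comment> \<open>As \<open>p = Suc q\<close>, the power has a last factor \<open>?s\<close>. It
    is evaluated at indices \<open>\<nu> - \<mu>\<close>, which lie in \<open>below \<nu>\<close>,
    where \<open>?s\<close> vanishes.\<close>
  have "(?s [^]\<^bsub>?R\<^esub> p) \<nu> = 0"
    using assms(2) by (simp add: q tate_mult)
  then have "(r [^]\<^bsub>?R\<^esub> p) \<nu> = (\<Sum>\<mu>\<in>below \<nu>. mterm (r \<mu> ^ p) (\<lambda>i. p * \<mu> i) \<nu>)"
    using tate_frobenius_split_off[OF fin assms(1,3,4), of \<nu>] by simp
  also have "\<dots> = (\<Sum>\<mu>\<in>below \<nu>. if \<mu> = (\<lambda>i. \<nu> i div p) then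
                 (if \<forall>i. p dvd \<nu> i then r (\<lambda>i. \<nu> i div p) ^ p else 0) else 0)"
  proof (rule sum.cong)
    fix \<mu>
    have "\<nu> = (\<lambda>i. p * \<mu> i) \<longleftrightarrow> \<mu> = (\<lambda>i. \<nu> i div p) \<and> (\<forall>i. p dvd \<nu> i)"
      using \<open>p > 0\<close> by (auto simp: fun_eq_iff)
    then show "mterm (r \<mu> ^ p) (\<lambda>i. p * \<mu> i) \<nu> = (if \<mu> = (\<lambda>i. \<nu> i div p) then
                 (if \<forall>i. p dvd \<nu> i then r (\<lambda>i. \<nu> i div p) ^ p else 0) else 0)"
      by (simp add: mterm_def)
  qed simp
  also have "\<dots> = (if \<forall>i. p dvd \<nu> i then r (\<lambda>i. \<nu> i div p) ^ p else 0)"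
    using fin by (simp add: sum.delta)
  finally show ?thesis .
qed

text \<open>The p-th power of \<open>r\<close> is supported on multiples of p, so only the indices
  \<open>p * \<kappa>\<close> with \<open>\<kappa> \<in> below \<nu>\<close> survive in the
  convolution. In the resulting sum a functional can pull each \<open>r \<kappa>\<close> out of its
  p-th power.\<close>

lemma tate_frobenius_mult_coeff:
  assumes "r \<in> tate_carrier v n" "\<nu> \<in> multi_idx n" "CHAR('a) = p" "p > 0"
  shows "(r [^]\<^bsub>tate_ring v n\<^esub> p \<otimes>\<^bsub>tate_ring v n\<^esub> x) (\<lambda>i. p * \<nu> i) =
         (\<Sum>\<kappa>\<in>below \<nu>. r \<kappa> ^ p * x (\<lambda>i. p * (\<nu> i - \<kappa> i)))"
proof -
  let ?R = "tate_ring v n"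
  let ?h = "\<lambda>\<kappa> i. p * \<kappa> i :: nat"
  have p\<nu>: "?h \<nu> \<in> multi_idx n"
    using assms by (simp add: multi_idx_def)
  have coeff: "(r [^]\<^bsub>?R\<^esub> p) \<mu> = (if \<forall>i. p dvd \<mu> i then r (\<lambda>i. \<mu> i div p) ^ p else 0)"
    if "\<mu> \<in> below (?h \<nu>)" for \<mu>
    using assms below_multi_idx[OF p\<nu> that] by (intro tate_frobenius_coeff)
  have "(r [^]\<^bsub>?R\<^esub> p \<otimes>\<^bsub>?R\<^esub> x) (?h \<nu>) =
      (\<Sum>\<mu>\<in>below (?h \<nu>). (r [^]\<^bsub>?R\<^esub> p) \<mu> * x (\<lambda>i. p * \<nu> i - \<mu> i))"
    using p\<nu> by (simp add: tate_mult)
  also have "\<dots> = (\<Sum>\<mu>\<in>?h ` below \<nu>. (r [^]\<^bsub>?R\<^esub> p) \<mu> * x (\<lambda>i. p * \<nu> i - \<mu> i))"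
  proof (rule sum.mono_neutral_right)
    show "finite (below (?h \<nu>))"
      using p\<nu> by (rule finite_below)
    show "?h ` below \<nu> \<subseteq> below (?h \<nu>)"
      by auto
    show "\<forall>\<mu>\<in>below (?h \<nu>) - ?h ` below \<nu>. (r [^]\<^bsub>?R\<^esub> p) \<mu> * x (\<lambda>i. p * \<nu> i - \<mu> i) = 0"
    proof
      fix \<mu> assume \<mu>: "\<mu> \<in> below (?h \<nu>) - ?h ` below \<nu>"
      have "\<not> (\<forall>i. p dvd \<mu> i)"
      proof
        assume dvd: "\<forall>i. p dvd \<mu> i"
        have "\<mu> i div p \<le> \<nu> i" for i
          using \<mu> div_le_mono[of "\<mu> i" "p * \<nu> i" p] \<open>p > 0\<close> by simp
        moreover have "\<mu> = ?h (\<lambda>i. \<mu> i div p)"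
          using dvd by simp
        ultimately have "\<mu> \<in> ?h ` below \<nu>"
          by (intro image_eqI[of _ _ "\<lambda>i. \<mu> i div p"]) auto
        with \<mu> show False by simp
      qed
      with \<mu> coeff[of \<mu>] show "(r [^]\<^bsub>?R\<^esub> p) \<mu> * x (\<lambda>i. p * \<nu> i - \<mu> i) = 0"
        by auto
    qed
  qed
  also have "\<dots> = (\<Sum>\<kappa>\<in>below \<nu>. (r [^]\<^bsub>?R\<^esub> p) (?h \<kappa>) * x (\<lambda>i. p * \<nu> i - p * \<kappa> i))"
    using \<open>p > 0\<close> by (subst sum.reindex) (auto simp: inj_on_def fun_eq_iff)
  also have "\<dots> = (\<Sum>\<kappa>\<in>below \<nu>. r \<kappa> ^ p * x (\<lambda>i. p * (\<nu> i - \<kappa> i)))"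
    using coeff \<open>p > 0\<close> by (intro sum.cong) (auto simp: diff_mult_distrib2)
  finally show ?thesis .
qed

section \<open>Splittings from continuous functionals, and back\<close>

text \<open>Continuity at 0 ensures that coefficients tending to 0 are sent to coefficients tending
  to 0. The functional does not depend on n, so a single one splits all the algebras.\<close>

lemma frobenius_split_of_functional:
  assumes p: "CHAR('a) = p" "p > 0"
    and g: "cont_lin_root_map v p g" "g x\<^sub>0 \<noteq> 0"
  shows "frobenius_split (tate_ring v n) p"
proof -
  let ?R = "tate_ring v n"
  have g_add: "g (x + y) = g x + g y" and g_lin: "g (c ^ p * x) = c * g x" for x y c
    using g(1) by (auto simp: cont_lin_root_map_def)
  \<comment> \<open>Since \<open>g 1\<close> may vanish, the argument is first multiplied by
    \<open>x\<^sub>0\<close>. Both additivity and p-inverse linearity survive this change, and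
    \<open>h 1 = 1\<close>.\<close>
  define h where "h x = g (x * x\<^sub>0) / g x\<^sub>0" for x
  have h_add: "h (x + y) = h x + h y" and h_lin: "h (c ^ p * x) = c * h x"
    and h_1: "h 1 = 1" for x y c
    using g(2) by (simp_all add: h_def distrib_right g_add add_divide_distrib mult.assoc g_lin)
  have h_0: "h 0 = 0"
    using h_lin[of 0 0] by simp
  have h_sum: "h (\<Sum>i\<in>I. k i) = (\<Sum>i\<in>I. h (k i))" for I and k :: "(nat \<Rightarrow> nat) \<Rightarrow> 'a"
    by (induction I rule: infinite_finite_induct) (auto simp: h_0 h_add)
  have h_cont: "\<exists>d>0. \<forall>y. v y < d \<longrightarrow> v (h y) < e" if "e > 0" for e
  proof -
    have g_0: "g 0 = 0"
      using g_lin[of 0 0] by simp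
    with g(2) have x0: "v x\<^sub>0 > 0" "v (g x\<^sub>0) > 0"
      using v_nonneg[of x\<^sub>0] v_nonneg[of "g x\<^sub>0"] v_eq_0_iff[of x\<^sub>0] v_eq_0_iff[of "g x\<^sub>0"]
      by (auto simp: less_le)
    have "e * v (g x\<^sub>0) > 0"
      using that x0 by simp
    with g_0 obtain d where d: "d > 0" "\<And>y. v y powr (1 / real p) < d \<Longrightarrow> v (g y) < e * v (g x\<^sub>0)"
      using g(1) unfolding cont_lin_root_map_def by (metis diff_zero)
    \<comment> \<open>The threshold is chosen so that \<open>y * x\<^sub>0\<close> has absolute
      value below \<open>d ^ p\<close>, that is, below \<open>d\<close> after taking the p-th
      root.\<close>
    have "v (h y) < e" if "v y < d ^ p / v x\<^sub>0" for y
    proof -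
      have "v (y * x\<^sub>0) < d ^ p"
        using that x0 by (simp add: v_mult field_simps)
      then have "v (y * x\<^sub>0) powr (1 / real p) < (d ^ p) powr (1 / real p)"
        using p by (intro powr_less_mono2) (auto simp: v_nonneg)
      also have "\<dots> = d"
        using d p by (simp add: powr_powr flip: powr_realpow)
      finally have "v (g (y * x\<^sub>0)) < e * v (g x\<^sub>0)"
        by (rule d)
      moreover have "v (h y) = v (g (y * x\<^sub>0)) / v (g x\<^sub>0)"
        by (simp only: h_def divide_inverse v_mult v_inverse)
      ultimately show ?thesis
        using x0 by (simp add: pos_divide_less_eq)
    qed
    moreover have "d ^ p / v x\<^sub>0 > 0"
      using d x0 by simp
    ultimately show ?thesis by blast
  qed
  define \<phi> where "\<phi> a = (\<lambda>\<nu>. h (a (\<lambda>i. p * \<nu> i)))" for a :: "(nat \<Rightarrow> nat) \<Rightarrow> 'a"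
  have p_idx: "(\<lambda>i. p * \<nu> i) \<in> multi_idx n \<longleftrightarrow> \<nu> \<in> multi_idx n" for \<nu>
    using p by (simp add: multi_idx_def)
  have "p_inv_linear ?R p \<phi>"
    unfolding p_inv_linear_def
  proof (intro conjI ballI)
    fix a assume "a \<in> carrier ?R"
    then have a: "a \<in> tate_carrier v n"
      by (simp add: tate_ring_simps)
    have "\<exists>N. \<forall>\<nu>\<in>multi_idx n. N \<le> tdeg n \<nu> \<longrightarrow> v (\<phi> a \<nu>) < e" if e: "e > 0" for e
    proof -
      obtain d where d: "d > 0" "\<And>y. v y < d \<Longrightarrow> v (h y) < e"
        using h_cont[OF e] by blast
      obtain N where N: "\<And>\<nu>. \<nu> \<in> multi_idx n \<Longrightarrow> N \<le> tdeg n \<nu> \<Longrightarrow> v (a \<nu>) < d"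
        using tate_carrier_small a d(1) by blast
      have "v (\<phi> a \<nu>) < e" if \<nu>: "\<nu> \<in> multi_idx n" "N \<le> tdeg n \<nu>" for \<nu>
      proof -
        \<comment> \<open>Multiplying exponents by p does not lower the degree, so the bound N
          obtained for \<open>a\<close> also works for \<open>\<phi> a\<close>.\<close>
        have "tdeg n (\<lambda>i. p * \<nu> i) = p * tdeg n \<nu>"
          by (simp add: tdeg_def sum_distrib_left)
        moreover have "tdeg n \<nu> \<le> p * tdeg n \<nu>"
          using p by simp
        ultimately have "v (a (\<lambda>i. p * \<nu> i)) < d"
          using \<nu> p_idx by (intro N) (simp, linarith)
        then show ?thesis
          unfolding \<phi>_def by (rule d(2))
      qed
      then show ?thesis by blast
    qed
    moreover have "\<phi> a \<nu> = 0" if "\<nu> \<notin> multi_idx n" for \<nu>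
      using that a by (simp add: \<phi>_def p_idx tate_carrier_outside h_0)
    ultimately show "\<phi> a \<in> carrier ?R"
      by (simp add: tate_ring_simps tate_carrier_def)
  next
    fix a b
    show "\<phi> (a \<oplus>\<^bsub>?R\<^esub> b) = \<phi> a \<oplus>\<^bsub>?R\<^esub> \<phi> b"
      by (simp add: tate_ring_simps \<phi>_def h_add)
  next
    fix r a assume "r \<in> carrier ?R" "a \<in> carrier ?R"
    then have r: "r \<in> tate_carrier v n"
      by (simp add: tate_ring_simps)
    show "\<phi> (r [^]\<^bsub>?R\<^esub> p \<otimes>\<^bsub>?R\<^esub> a) = r \<otimes>\<^bsub>?R\<^esub> \<phi> a"
    proof
      fix \<nu>
      show "\<phi> (r [^]\<^bsub>?R\<^esub> p \<otimes>\<^bsub>?R\<^esub> a) \<nu> = (r \<otimes>\<^bsub>?R\<^esub> \<phi> a) \<nu>"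
      proof (cases "\<nu> \<in> multi_idx n")
        case True
        show ?thesis
          unfolding \<phi>_def tate_frobenius_mult_coeff[OF r True p]
          using True by (simp add: tate_mult h_sum h_lin)
      next
        case False
        then show ?thesis by (simp add: \<phi>_def tate_mult p_idx h_0)
      qed
    qed
  qed
  moreover have "\<phi> \<one>\<^bsub>?R\<^esub> = \<one>\<^bsub>?R\<^esub>"
    using p by (auto simp: tate_ring_simps \<phi>_def mterm_def h_0 h_1 fun_eq_iff)
  ultimately show ?thesis
    unfolding frobenius_split_def by blast
qed

lemma nonzero_of_frobenius_split:
  assumes "frobenius_split (tate_ring v n) p"
  shows "has_nonzero_p_inv_linear (tate_ring v n) p"
proof -
  have "\<one>\<^bsub>tate_ring v n\<^esub> \<in> carrier (tate_ring v n)"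
    by (simp add: tate_ring_simps mterm_carrier zero_multi_idx)
  moreover have "\<one>\<^bsub>tate_ring v n\<^esub> \<noteq> \<zero>\<^bsub>tate_ring v n\<^esub>"
    by (auto simp: tate_ring_simps mterm_def fun_eq_iff)
  ultimately show ?thesis
    using assms unfolding frobenius_split_def has_nonzero_p_inv_linear_def by metis
qed

section \<open>Series in powers of the first variable\<close>

abbreviation axis :: "nat \<Rightarrow> nat \<Rightarrow> nat" where
  "axis k \<equiv> \<lambda>i. if i = 0 then k else 0"

lemma axis_multi_idx: "n > 0 \<Longrightarrow> axis k \<in> multi_idx n"
  by (auto simp: multi_idx_def)

lemma tdeg_axis: "n > 0 \<Longrightarrow> tdeg n (axis k) = k"
  by (simp add: tdeg_def sum.delta)

lemma tate_mult_axis: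
  assumes "\<nu> \<in> multi_idx n"
  shows "(mterm 1 (axis s) \<otimes>\<^bsub>tate_ring v n\<^esub> b) \<nu> = (if s \<le> \<nu> 0 then b (\<lambda>i. \<nu> i - axis s i) else 0)"
proof -
  have "axis s \<in> below \<nu> \<longleftrightarrow> s \<le> \<nu> 0"
    by auto
  then show ?thesis
    unfolding tate_mult_mterm[OF assms] by simp
qed

text \<open>The series \<open>\<Sum>\<^sub>m c\<^sub>m X\<^sub>0\<^bsup>sm\<^esup>\<close>.\<close>
definition axis_series :: "nat \<Rightarrow> (nat \<Rightarrow> 'a) \<Rightarrow> (nat \<Rightarrow> nat) \<Rightarrow> 'a" where
  "axis_series s c \<nu> = (if \<nu> = axis (\<nu> 0) \<and> s dvd \<nu> 0 then c (\<nu> 0 div s) else 0)"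

text \<open>Convergence to 0 is spelled out through \<open>v\<close>, since the type of the field
  carries no metric of its own.\<close>

definition null_seq :: "(nat \<Rightarrow> 'a) \<Rightarrow> bool" where
  "null_seq c \<longleftrightarrow> (\<forall>e>0. \<exists>N. \<forall>m\<ge>N. v (c m) < e)"

lemma null_seq_Suc: "null_seq c \<Longrightarrow> null_seq (\<lambda>m. c (Suc m))"
  unfolding null_seq_def by (meson le_SucI)

lemma axis_series_carrier:
  assumes "n > 0" "s > 0" "null_seq c"
  shows "axis_series s c \<in> tate_carrier v n"
  unfolding tate_carrier_def
proof (safe, goal_cases)
  case (1 \<nu>)
  then show ?case
    using axis_multi_idx[OF \<open>n > 0\<close>, of "\<nu> 0"] by (auto simp: axis_series_def)
next
  case (2 e)
  then obtain N where N: "\<And>m. m \<ge> N \<Longrightarrow> v (c m) < e"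
    using \<open>null_seq c\<close> by (auto simp: null_seq_def)
  have "v (axis_series s c \<nu>) < e" if "s * N \<le> tdeg n \<nu>" for \<nu>
  proof (cases "\<nu> = axis (\<nu> 0) \<and> s dvd \<nu> 0")
    case True
    then have "tdeg n \<nu> = \<nu> 0"
      using tdeg_axis[OF \<open>n > 0\<close>, of "\<nu> 0"] by simp
    with that have "N \<le> \<nu> 0 div s"
      using \<open>s > 0\<close> by (simp add: less_eq_div_iff_mult_less_eq mult.commute)
    with True show ?thesis
      using N by (simp add: axis_series_def)
  next
    case False
    with 2 show ?thesis by (auto simp: axis_series_def v_0)
  qed
  then show ?case by blast
qed

text \<open>A Horner step: the constant term is split off and \<open>X_0^s\<close> is factored out
  of the rest. Being a finite identity, it can be fed to an additive map about whose continuity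
  nothing is known.\<close>

lemma axis_series_unfold:
  assumes "n > 0" "s > 0"
  shows "axis_series s c = mterm (c 0) (\<lambda>_. 0) \<oplus>\<^bsub>tate_ring v n\<^esub>
           mterm 1 (axis s) \<otimes>\<^bsub>tate_ring v n\<^esub> axis_series s (\<lambda>m. c (Suc m))"
proof
  fix \<nu>
  let ?S = "axis_series s (\<lambda>m. c (Suc m))"
  let ?rhs = "mterm (c 0) (\<lambda>_. 0) \<nu> + (mterm 1 (axis s) \<otimes>\<^bsub>tate_ring v n\<^esub> ?S) \<nu>"
  have "axis_series s c \<nu> = ?rhs"
  proof (cases "\<nu> = axis (\<nu> 0)")
    case True
    then obtain k where k: "\<nu> = axis k" by blast
    have minus: "(\<lambda>i. axis k i - axis s i) = axis (k - s)"
      by auto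
    have "?rhs = (if k = 0 then c 0 else 0) + (if s \<le> k then ?S (axis (k - s)) else 0)"
      unfolding k tate_mult_axis[OF axis_multi_idx[OF \<open>n > 0\<close>]] minus
      by (auto simp: mterm_def fun_eq_iff)
    also have "\<dots> = axis_series s c (axis k)"
      using \<open>s > 0\<close> by (auto simp: axis_series_def le_div_geq dvd_minus_self dest: dvd_imp_le)
    finally show ?thesis by (simp only: k)
  next
    case False
    \<comment> \<open>Some coordinate other than 0 is nonzero. Subtracting \<open>axis s\<close>
      leaves it unchanged, so the shifted index is still off the axis.\<close>
    then obtain j where j: "\<nu> j \<noteq> axis (\<nu> 0) j"
      by (meson ext)
    then have "\<nu> j - axis s j \<noteq> axis (\<nu> 0 - axis s 0) j"
      by (cases "j = 0") simp_all
    then have "(\<lambda>i. \<nu> i - axis s i) \<noteq> axis (\<nu> 0 - axis s 0)"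
      by metis
    then have "?S (\<lambda>i. \<nu> i - axis s i) = 0"
      by (simp add: axis_series_def)
    moreover have "mterm (c 0) (\<lambda>_. 0) \<nu> = 0"
      using False by (auto simp: mterm_def)
    moreover have "axis_series s c \<nu> = 0"
      using False by (auto simp: axis_series_def)
    moreover have "(mterm 1 (axis s) \<otimes>\<^bsub>tate_ring v n\<^esub> ?S) \<nu> = 0" if "\<nu> \<notin> multi_idx n"
      using that by (simp add: tate_mult)
    ultimately show ?thesis
      by (cases "\<nu> \<in> multi_idx n") (simp_all only: tate_mult_axis if_cancel add_0 not_False_eq_True)
  qed
  then show "axis_series s c \<nu> = (mterm (c 0) (\<lambda>_. 0) \<oplus>\<^bsub>tate_ring v n\<^esub>
           mterm 1 (axis s) \<otimes>\<^bsub>tate_ring v n\<^esub> ?S) \<nu>"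
    by (simp add: tate_ring_simps)
qed

text \<open>A \<open>p\<^sup>-\<^sup>1\<close>-linear map need not be continuous, but it commutes with multiplication by
  \<open>X\<^sub>0\<^bsup>pt\<^esup>\<close> up to a \<open>p\<close>-th root, so low-order coefficients of its value on an infinite sum in
  powers of \<open>X\<^sub>0\<^bsup>pt\<^esup>\<close> depend only on finitely many summands.\<close>
lemma p_inv_linear_axis_series_coeff:
  assumes "n > 0" "p > 0" "t > 0" "\<mu> \<in> multi_idx n" "\<mu> 0 < t"
    and \<phi>: "p_inv_linear (tate_ring v n) p \<phi>" and a: "a \<in> tate_carrier v n" and "null_seq c"
  shows "\<phi> (axis_series (p * t) c \<otimes>\<^bsub>tate_ring v n\<^esub> a) (\<lambda>i. \<mu> i + axis (t * M) i) =
    (\<Sum>m\<le>M. \<phi> (mterm (c m) (\<lambda>_. 0) \<otimes>\<^bsub>tate_ring v n\<^esub> a) (\<lambda>i. \<mu> i + axis (t * (M - m)) i))"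
  using \<open>null_seq c\<close>
\<comment> \<open>The sequence is generalised because each Horner step replaces it by its
  shift.\<close>
proof (induction M arbitrary: c)
  interpret cring "tate_ring v n" by (rule cring_tate_ring)
  let ?R = "tate_ring v n"
  let ?\<Phi> = "\<lambda>x. \<phi> (mterm x (\<lambda>_. 0) \<otimes>\<^bsub>?R\<^esub> a)"
  have step: "\<phi> (axis_series (p * t) c \<otimes>\<^bsub>?R\<^esub> a) \<nu> = ?\<Phi> (c 0) \<nu> +
      (if t \<le> \<nu> 0 then \<phi> (axis_series (p * t) (\<lambda>m. c (Suc m)) \<otimes>\<^bsub>?R\<^esub> a) (\<lambda>i. \<nu> i - axis t i) else 0)"
    if c: "null_seq c" and \<nu>: "\<nu> \<in> multi_idx n" for c \<nu>
  proof -
    let ?S = "axis_series (p * t) (\<lambda>m. c (Suc m))"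
    let ?X = "mterm 1 (axis t) :: (nat \<Rightarrow> nat) \<Rightarrow> 'a"
    \<comment> \<open>The factor \<open>X_0^(p t)\<close> is a p-th power, so \<open>\<phi>\<close>
      releases it as \<open>X_0^t\<close>. This is why the series runs in steps of
      \<open>p * t\<close>.\<close>
    have X_pow: "?X [^]\<^bsub>?R\<^esub> p = mterm 1 (axis (p * t))"
      using axis_multi_idx[OF \<open>n > 0\<close>, of t]
      by (simp add: mterm_pow if_distrib[of "\<lambda>x. p * x"] cong: if_cong)
    have closed: "?S \<in> carrier ?R" "a \<in> carrier ?R" "mterm (c 0) (\<lambda>_. 0) \<in> carrier ?R" "?X \<in> carrier ?R"
      using assms c by (auto simp: tate_ring_simps axis_series_carrier null_seq_Suc mterm_carrier
          zero_multi_idx axis_multi_idx)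
    have "axis_series (p * t) c \<otimes>\<^bsub>?R\<^esub> a =
        mterm (c 0) (\<lambda>_. 0) \<otimes>\<^bsub>?R\<^esub> a \<oplus>\<^bsub>?R\<^esub> ?X [^]\<^bsub>?R\<^esub> p \<otimes>\<^bsub>?R\<^esub> (?S \<otimes>\<^bsub>?R\<^esub> a)"
      using axis_series_unfold[OF \<open>n > 0\<close>, of "p * t" c] assms closed
      by (simp add: l_distr m_assoc flip: X_pow)
    then have "\<phi> (axis_series (p * t) c \<otimes>\<^bsub>?R\<^esub> a) = ?\<Phi> (c 0) \<oplus>\<^bsub>?R\<^esub> ?X \<otimes>\<^bsub>?R\<^esub> \<phi> (?S \<otimes>\<^bsub>?R\<^esub> a)"
      using \<phi> closed by (simp add: p_inv_linear_def)
    then have "\<phi> (axis_series (p * t) c \<otimes>\<^bsub>?R\<^esub> a) \<nu> = ?\<Phi> (c 0) \<nu> + (?X \<otimes>\<^bsub>?R\<^esub> \<phi> (?S \<otimes>\<^bsub>?R\<^esub> a)) \<nu>"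
      by (simp add: tate_ring_simps)
    then show ?thesis
      unfolding tate_mult_axis[OF \<nu>] .
  qed
  have idx: "(\<lambda>i. \<mu> i + axis k i) \<in> multi_idx n" for k
    using assms by (auto simp: multi_idx_def)
  {
    case 0
    \<comment> \<open>Since \<open>\<mu> 0 < t\<close>, the tail, which carries a factor
      \<open>X_0^t\<close>, does not reach the coefficient at \<open>\<mu>\<close>.\<close>
    then show ?case
      using step[OF 0 idx[of 0]] \<open>\<mu> 0 < t\<close> by (simp cong: if_cong)
  next
    case (Suc M)
    have shift: "(\<lambda>i. \<mu> i + axis (t * Suc M) i - axis t i) = (\<lambda>i. \<mu> i + axis (t * M) i)"
      by auto
    have "\<phi> (axis_series (p * t) c \<otimes>\<^bsub>?R\<^esub> a) (\<lambda>i. \<mu> i + axis (t * Suc M) i) =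
      ?\<Phi> (c 0) (\<lambda>i. \<mu> i + axis (t * Suc M) i) +
      \<phi> (axis_series (p * t) (\<lambda>m. c (Suc m)) \<otimes>\<^bsub>?R\<^esub> a) (\<lambda>i. \<mu> i + axis (t * M) i)"
      using step[OF Suc.prems idx[of "t * Suc M"]] unfolding shift by simp
    then show ?case
      unfolding Suc.IH[OF null_seq_Suc[OF Suc.prems]] by (subst sum.atMost_Suc_shift) (simp only: diff_zero diff_Suc_Suc)
  }
qed

section \<open>Automatic continuity of the coefficient functional\<close>

text \<open>By additivity, a discontinuity at any point gives arbitrarily small arguments with
  values of size at least a fixed \<open>e\<close>. Scaling the argument by \<open>b ^ p\<close>
  multiplies the value by \<open>b\<close>; with \<open>b\<close> large but fixed, the argument can
  still be made as small as desired.\<close>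

lemma unbounded_of_discontinuous:
  assumes "abs_nontrivial v" "p > 0"
    and f_add: "\<And>x y. f (x + y) = f x + f y"
    and f_lin: "\<And>c x. f (c ^ p * x) = c * f x"
    and "\<not> cont_lin_root_map v p f" and "d > 0"
  shows "\<exists>y. v y < d \<and> v (f y) > B"
proof -
  obtain x e where e: "e > 0"
    and near: "\<And>d. d > 0 \<Longrightarrow> \<exists>y. v (y - x) powr (1 / real p) < d \<and> e \<le> v (f y - f x)"
    using assms(5) f_add f_lin unfolding cont_lin_root_map_def not_less[symmetric] by blast
  obtain u where u: "u \<noteq> 0" "v u \<noteq> 1"
    using assms(1) by (auto simp: abs_nontrivial_def)
  \<comment> \<open>Nontriviality provides an element of absolute value above 1: either
    \<open>u\<close> itself or its inverse.\<close>
  obtain w where w: "v w > 1"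
  proof (cases "v u > 1")
    case True
    then show ?thesis by (rule that)
  next
    case False
    with u v_nonneg[of u] v_eq_0_iff[of u] have "0 < v u" "v u < 1"
      by auto
    then have "v (inverse u) > 1"
      by (simp add: v_inverse one_less_inverse)
    then show ?thesis by (rule that)
  qed
  obtain N where N: "B / e < v w ^ N"
    using real_arch_pow[OF w] by blast
  define b where "b = w ^ N"
  have b: "v b > 0" "B < v b * e"
    using w N e by (auto simp: b_def v_power field_simps)
  \<comment> \<open>Scaling by \<open>b ^ p\<close> turns the bound \<open>E\<close> into
    \<open>d\<close>. The failure of continuity is phrased with p-th roots, hence it is applied to
    the p-th root of \<open>E\<close>.\<close>
  define E where "E = d / v b ^ p"
  have "E > 0"
    using b \<open>d > 0\<close> by (simp add: E_def)
  then obtain y where y: "v (y - x) powr (1 / real p) < E powr (1 / real p)" "e \<le> v (f y - f x)"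
    using near[of "E powr (1 / real p)"] by auto
  have "v (y - x) < E"
  proof (rule ccontr)
    assume "\<not> v (y - x) < E"
    then have "E powr (1 / real p) \<le> v (y - x) powr (1 / real p)"
      using \<open>E > 0\<close> by (intro powr_mono2) auto
    with y(1) show False by simp
  qed
  then have "v (b ^ p * (y - x)) < d"
    unfolding v_mult v_power using b by (simp add: E_def field_simps)
  moreover have "f y - f x = f (y - x)"
    using f_add[of "y - x" x] by simp
  then have "v (f (b ^ p * (y - x))) > B"
    using b less_le_trans[OF b(2) mult_left_mono[OF y(2)]] by (simp add: f_lin v_mult)
  ultimately show ?thesis by blast
qed

text \<open>Continuity follows by a gliding hump argument: each new coefficient is small, yet its
  functional value outweighs all earlier contributions, so the image of the resulting convergent
  series would have coefficients that do not tend to 0.\<close>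

lemma functional_of_nonzero:
  assumes "abs_nontrivial v" "p > 0" "n > 0" "has_nonzero_p_inv_linear (tate_ring v n) p"
  shows "\<exists>g. cont_lin_root_map v p g \<and> (\<exists>x. g x \<noteq> 0)"
proof -
  interpret cring "tate_ring v n" by (rule cring_tate_ring)
  let ?R = "tate_ring v n"
  obtain \<phi> a where \<phi>: "p_inv_linear ?R p \<phi>" and a: "a \<in> carrier ?R" "\<phi> a \<noteq> \<zero>\<^bsub>?R\<^esub>"
    using assms(4) by (auto simp: has_nonzero_p_inv_linear_def)
  have \<phi>_closed: "\<phi> x \<in> tate_carrier v n" if "x \<in> carrier ?R" for x
    using \<phi> that by (simp add: p_inv_linear_def flip: tate_ring_simps(1))
  obtain \<mu> where \<mu>: "\<phi> a \<mu> \<noteq> 0"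
    using a(2) by (auto simp: tate_ring_simps)
  have \<mu>_idx: "\<mu> \<in> multi_idx n"
    using \<mu> tate_carrier_outside[OF \<phi>_closed[OF a(1)]] by blast
  let ?C = "\<lambda>c. mterm c (\<lambda>_. 0) :: (nat \<Rightarrow> nat) \<Rightarrow> 'a"
  define \<Phi> where "\<Phi> c = \<phi> (?C c \<otimes>\<^bsub>?R\<^esub> a)" for c
  define f where "f c = \<Phi> c \<mu>" for c
  have C: "?C c \<in> carrier ?R" for c
    by (simp add: tate_ring_simps mterm_carrier zero_multi_idx)
  have f_add: "f (x + y) = f x + f y" for x y
  proof -
    have "?C (x + y) = ?C x \<oplus>\<^bsub>?R\<^esub> ?C y"
      by (auto simp: tate_ring_simps mterm_def)
    then have "\<Phi> (x + y) = \<Phi> x \<oplus>\<^bsub>?R\<^esub> \<Phi> y"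
      using \<phi> a(1) C by (simp add: \<Phi>_def l_distr p_inv_linear_def)
    then show ?thesis by (simp add: f_def tate_ring_simps)
  qed
  have f_lin: "f (c ^ p * x) = c * f x" for c x
  proof -
    have "?C (c ^ p * x) = ?C c [^]\<^bsub>?R\<^esub> p \<otimes>\<^bsub>?R\<^esub> ?C x"
      by (simp add: mterm_pow mterm_mult zero_multi_idx)
    then have "\<Phi> (c ^ p * x) = ?C c \<otimes>\<^bsub>?R\<^esub> \<Phi> x"
      using \<phi> a(1) C by (simp add: \<Phi>_def m_assoc p_inv_linear_def)
    then show ?thesis
      using \<mu>_idx by (simp add: f_def tate_mult_mterm)
  qed
  have "f 1 \<noteq> 0"
    using a(1) \<mu> by (simp add: f_def \<Phi>_def flip: tate_ring_simps(4)[of v n])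
  moreover have "cont_lin_root_map v p f"
  proof (rule ccontr)
    assume "\<not> cont_lin_root_map v p f"
    note unbounded = unbounded_of_discontinuous[OF assms(1,2) f_add f_lin this]
    \<comment> \<open>Any \<open>t > \<mu> 0\<close> keeps the summands after the M-th from
      contributing to the coefficient at \<open>\<mu> + t M\<close>.\<close>
    define t where "t = Suc (\<mu> 0)"
    \<comment> \<open>\<open>\<sigma> c M m\<close> is the contribution of \<open>c m\<close> to the
      coefficient at \<open>\<mu> + t M\<close>. For \<open>m < M\<close> it is already fixed when
      \<open>c M\<close> is chosen.\<close>
    define \<sigma> where "\<sigma> c M m = \<Phi> (c m) (\<lambda>i. \<mu> i + axis (t * (M - m)) i)" for c :: "nat \<Rightarrow> 'a" and M m
    define P where "P c M y \<longleftrightarrow> v y < 1 / Suc M \<and> v (f y) > 1 + (\<Sum>m<M. v (\<sigma> c M m))"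
      for c :: "nat \<Rightarrow> 'a" and M y
    have "\<exists>c. \<forall>M. P c M (c M)"
    \<comment> \<open>Recursive choice is possible because \<open>P c M\<close> looks at
      \<open>c\<close> only below M.\<close>
    proof (rule dependent_wellorder_choice)
      show "P c M y = P c' M y" if "\<And>m. m < M \<Longrightarrow> c m = c' m" for y c c' M
        using that by (simp add: P_def \<sigma>_def)
      show "\<exists>y. P c M y" for M c
        unfolding P_def by (rule unbounded) simp
    qed
    then obtain c where c: "\<And>M. v (c M) < 1 / Suc M" "\<And>M. v (f (c M)) > 1 + (\<Sum>m<M. v (\<sigma> c M m))"
      by (auto simp: P_def)
    have "null_seq c"
      unfolding null_seq_def
    proof safe
      fix e :: real assume "e > 0"
      then obtain N where N: "1 / Suc N < e"
        by (metis nat_approx_posE)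
      have "v (c m) < e" if "m \<ge> N" for m
      proof -
        have "1 / real (Suc m) \<le> 1 / Suc N"
          using that by (simp add: frac_le)
        with c(1)[of m] N show ?thesis by linarith
      qed
      then show "\<exists>N. \<forall>m\<ge>N. v (c m) < e" by blast
    qed
    define b where "b = \<phi> (axis_series (p * t) c \<otimes>\<^bsub>?R\<^esub> a)"
    have "b \<in> tate_carrier v n"
      unfolding b_def using a(1) \<open>null_seq c\<close> assms
      by (intro \<phi>_closed m_closed) (auto simp: tate_ring_simps t_def axis_series_carrier)
    then obtain N where N: "\<And>\<nu>. \<nu> \<in> multi_idx n \<Longrightarrow> N \<le> tdeg n \<nu> \<Longrightarrow> v (b \<nu>) < 1"
      using tate_carrier_small zero_less_one by blast
    let ?\<nu> = "\<lambda>i. \<mu> i + axis (t * N) i"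
    have "tdeg n ?\<nu> = tdeg n \<mu> + t * N"
      using tdeg_axis[OF assms(3)] by (simp add: tdeg_def sum.distrib)
    moreover have "N \<le> t * N"
      by (simp add: t_def)
    moreover have "?\<nu> \<in> multi_idx n"
      using \<mu>_idx assms(3) by (auto simp: multi_idx_def)
    ultimately have small: "v (b ?\<nu>) < 1"
      by (intro N) linarith+
    have "b ?\<nu> = (\<Sum>m\<le>N. \<sigma> c N m)"
      unfolding b_def \<sigma>_def \<Phi>_def using a(1) \<mu>_idx \<phi> \<open>null_seq c\<close> assms
      by (intro p_inv_linear_axis_series_coeff) (auto simp: t_def tate_ring_simps)
    \<comment> \<open>The last summand has shift \<open>t * (N - N) = 0\<close>, so it is the
      coefficient at \<open>\<mu>\<close> itself, namely \<open>f (c N)\<close>.\<close>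
    also have "\<dots> = (\<Sum>m<N. \<sigma> c N m) + f (c N)"
      by (simp add: \<sigma>_def f_def flip: lessThan_Suc_atMost cong: if_cong)
    finally have "f (c N) = b ?\<nu> + - (\<Sum>m<N. \<sigma> c N m)"
      by simp
    then have "v (f (c N)) \<le> max (v (b ?\<nu>)) (v (\<Sum>m<N. \<sigma> c N m))"
      using v_add[of "b ?\<nu>" "- (\<Sum>m<N. \<sigma> c N m)"] by (simp add: v_uminus)
    moreover have "v (\<Sum>m<N. \<sigma> c N m) \<le> (\<Sum>m<N. v (\<sigma> c N m))"
      by (rule v_sum_le)
    moreover have "(\<Sum>m<N. v (\<sigma> c N m)) \<ge> 0"
      by (intro sum_nonneg v_nonneg)
    ultimately show False
      using c(2)[of N] small by linarith
  qed
  ultimately show ?thesis by blast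
qed

end

theorem theoremB:
  fixes v :: "'a::field \<Rightarrow> real" and p :: nat
  assumes "nonarch_abs v" and "abs_complete v" and "abs_nontrivial v"
    and "CHAR('a) = p" and "p > 0"
  shows "((\<forall>n>0. frobenius_split (tate_ring v n) p)
           \<longleftrightarrow> (\<forall>n>0. has_nonzero_p_inv_linear (tate_ring v n) p)) \<and>
         ((\<forall>n>0. has_nonzero_p_inv_linear (tate_ring v n) p)
           \<longleftrightarrow> (\<exists>n>0. has_nonzero_p_inv_linear (tate_ring v n) p)) \<and>
         ((\<exists>n>0. has_nonzero_p_inv_linear (tate_ring v n) p)
           \<longleftrightarrow> has_nonzero_p_inv_linear (tate_ring v 1) p) \<and>
         (has_nonzero_p_inv_linear (tate_ring v 1) p
           \<longleftrightarrow> frobenius_split (tate_ring v 1) p) \<and>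
         (frobenius_split (tate_ring v 1) p
           \<longleftrightarrow> (\<exists>g. cont_lin_root_map v p g \<and> (\<exists>x. g x \<noteq> 0)))"
proof -
  interpret nonarch_field v by unfold_locales fact
  have "\<forall>n>0. frobenius_split (tate_ring v n) p"
    if "\<exists>g. cont_lin_root_map v p g \<and> (\<exists>x. g x \<noteq> 0)"
    using that frobenius_split_of_functional[OF assms(4,5)] by blast
  moreover have "\<exists>g. cont_lin_root_map v p g \<and> (\<exists>x. g x \<noteq> 0)"
    if "n > 0" "has_nonzero_p_inv_linear (tate_ring v n) p" for n
    using functional_of_nonzero[OF assms(3,5)] that by blast
  \<comment> \<open>The implications close a cycle: splittings for all n give nonzero maps for all
    n, any one of these gives a functional, and a functional gives splittings for all n. The
    conditions on one variable are the instance n = 1.\<close>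
  ultimately show ?thesis
    using nonzero_of_frobenius_split zero_less_one by metis
qed

end
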